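(* Let $g_1,\dots,g_m:\mathbb{R}^n\to\mathbb{R}$ be differentiable convex functions that are definable in the same o-minimal structure on $(\mathbb{R},+,\cdot)$. Assume that $C_0=\{x\in\mathbb{R}^n \mid g_1(x)\le 0,\dots,g_m(x)\le 0\}$ is nonempty and that, for some $x_0\in\mathbb{R}^n$, $g_i(x_0)<0$ for all $i\in\{1,\dots,p\}$, where $p<m$. Then there exists $\varepsilon>0$ such that, for all $\mu_{p+1},\dots,\mu_m\in(0,\varepsilon)$, the Mangasarian-Fromovitz constraint qualification holds at every point of $$\{x\in\mathbb{R}^n \mid g_1(x)\le 0,\dots,g_p(x)\le 0,\ g_{p+1}(x)\le\mu_{p+1},\dots,g_m(x)\le\mu_m\}.$$
   Context: An o-minimal structure on $(\mathbb{R},+,\cdot)$ is a sequence $(\mathcal{O}_p)_{p\in\mathbb{N}}$ where each $\mathcal{O}_p$ is a Boolean algebra of subsets of $\mathbb{R}^p$ such that: if $A\in\mathcal{O}_p$ then $A\times\mathbb{R},\ \mathbb{R}\times A\in\mathcal{O}_{p+1}$; if $A\in\mathcal{O}_{p+1}$ then its projection on the first $p$ coordinates is in $\mathcal{O}_p$; $\mathcal{O}_p$ contains all zero sets of real polynomials on $\mathbb{R}^p$; and the elements of $\mathcal{O}_1$ are exactly the finite unions of points and intervals. A set is definable if it belongs to the structure; a function is definable if its graph is. For a set of the form $\{x \mid g_i(x)\le\mu_i,\ i\in S\}$ with $S$ a finite index set and $\mu_i\in\mathbb{R}$, a point $x$ of the set satisfies the Mangasarian-Fromovitz constraint qualification if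 there exists $y\in\mathbb{R}^n$ with $\langle y,\nabla g_i(x)\rangle<0$ for every $i\in S$ with $g_i(x)=\mu_i$ (vacuous if there is no such $i$). *)

theory Defs
  imports "HOL-Analysis.Analysis"
begin

text \<open>An o-minimal structure involves the spaces \<open>\<real>\<^sup>p\<close> for all \<open>p\<close> at once, so its members are
  sets of lists of reals, \<open>\<real>\<^sup>p\<close> being the set of lists of length \<open>p\<close>. The functions under
  study live on \<open>real ^ 'n\<close>; an enumeration of the index type \<open>'n\<close> links the two.\<close>

definition real_tuples :: "nat \<Rightarrow> real list set" where
  "real_tuples p = {xs. length xs = p}"

text \<open>A polynomial in \<open>p\<close> variables is given by a finite set \<open>E\<close> of exponent vectors, of which
  only the entries below \<open>p\<close> matter, and their coefficients \<open>c\<close>.\<close>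

definition poly_zero_set :: "nat \<Rightarrow> (nat \<Rightarrow> nat) set \<Rightarrow> ((nat \<Rightarrow> nat) \<Rightarrow> real) \<Rightarrow> real list set" where
  "poly_zero_set p E c =
     {xs \<in> real_tuples p. (\<Sum>\<alpha>\<in>E. c \<alpha> * (\<Prod>i<p. (xs ! i) ^ \<alpha> i)) = 0}"

text \<open>In the last clause, points are covered because singletons are intervals in the sense of
  \<^const>\<open>is_interval\<close>, which also includes unbounded intervals of any kind.\<close>

definition o_minimal_structure :: "(nat \<Rightarrow> real list set set) \<Rightarrow> bool" where
  "o_minimal_structure \<O> \<longleftrightarrow>
     (\<forall>p. algebra (real_tuples p) (\<O> p)) \<and>
     (\<forall>p. \<forall>A\<in>\<O> p. {xs @ [t] |xs t. xs \<in> A} \<in> \<O> (Suc p) \<and> {t # xs |xs t. xs \<in> A} \<in> \<O> (Suc p)) \<and>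
     (\<forall>p. \<forall>A\<in>\<O> (Suc p). take p ` A \<in> \<O> p) \<and>
     (\<forall>p E c. finite E \<longrightarrow> poly_zero_set p E c \<in> \<O> p) \<and>
     \<O> 1 = {(\<lambda>t. [t]) ` \<Union>\<I> |\<I>. finite \<I> \<and> (\<forall>I\<in>\<I>. is_interval I)}"

definition coords :: "'n list \<Rightarrow> real ^ 'n \<Rightarrow> real list" where
  "coords js x = map (\<lambda>j. x $ j) js"

text \<open>Here \<open>js\<close> is meant to list every element of \<open>'n\<close> exactly once; it fixes the order of the
  coordinates in the graph.\<close>

definition definable_fun ::
    "(nat \<Rightarrow> real list set set) \<Rightarrow> 'n list \<Rightarrow> (real ^ 'n \<Rightarrow> real) \<Rightarrow> bool" where
  "definable_fun \<O> js f \<longleftrightarrow> range (\<lambda>x. coords js x @ [f x]) \<in> \<O> (Suc (length js))"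

text \<open>Meaningful only where \<open>f\<close> is differentiable; the gradient is then unique.\<close>

definition gradient :: "('a::real_inner \<Rightarrow> real) \<Rightarrow> 'a \<Rightarrow> 'a" where
  "gradient f x = (THE D. GDERIV f x :> D)"

definition constraint_set :: "'i set \<Rightarrow> ('i \<Rightarrow> 'a \<Rightarrow> real) \<Rightarrow> ('i \<Rightarrow> real) \<Rightarrow> 'a set" where
  "constraint_set S g \<mu> = {x. \<forall>i\<in>S. g i x \<le> \<mu> i}"

text \<open>Mangasarian-Fromovitz constraint qualification at a point \<open>x\<close> of
  \<open>constraint_set S g \<mu>\<close>.\<close>

definition MFCQ :: "'i set \<Rightarrow> ('i \<Rightarrow> 'a::real_inner \<Rightarrow> real) \<Rightarrow> ('i \<Rightarrow> real) \<Rightarrow> 'a \<Rightarrow> bool" where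
  "MFCQ S g \<mu> x \<longleftrightarrow> (\<exists>y. \<forall>i\<in>S. g i x = \<mu> i \<longrightarrow> y \<bullet> gradient (g i) x < 0)"

end

theory Submission imports Defs begin

text \<open>
  The claim is Slater's condition in disguise, and every positive \<open>\<epsilon>\<close> works. Let \<open>x\<^sub>*\<close> be a point where all
  constraints are at most \<open>0\<close>. It satisfies the relaxed constraints strictly, because their levels
  are positive, and the others at least weakly. The point \<open>x0\<close> satisfies the others strictly. Moving
  from \<open>x\<^sub>*\<close> slightly towards \<open>x0\<close> therefore makes every constraint strict at once: by convexity the
  unrelaxed ones become negative immediately, and the relaxed ones keep their slack for a short while
  (\<open>common_strict_point\<close>).

  Given a point \<open>z\<close> at which all constraints are strict, the direction \<open>z - x\<close> witnesses the
  constraint qualification at any \<open>x\<close>: a convex function lies above its tangents, so along \<open>z - x\<close>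
  the slope of an active constraint is at most the negative number \<open>g i z - g i x\<close>
  (\<open>Slater_imp_MFCQ\<close>).
\<close>

text \<open>Over a Euclidean space the derivative \<open>f'\<close> is represented by the vector \<open>adjoint f' 1\<close>, since
  \<open>h \<bullet> adjoint f' 1 = f' h \<bullet> 1\<close>. A vector is determined by its inner products, so the definite
  description in \<^const>\<open>gradient\<close> picks this one.\<close>

lemma GDERIV_gradient:
  fixes f :: "'a::euclidean_space \<Rightarrow> real"
  assumes "f differentiable (at x)"
  shows "GDERIV f x :> gradient f x"
proof -
  obtain f' where f': "(f has_derivative f') (at x)"
    using assms by (auto simp: differentiable_def)
  define D where "D = adjoint f' 1"
  have "linear f'"
    using f' by (rule has_derivative_linear)
  then have "f' h = h \<bullet> D" for h
    using adjoint_works[of f' h 1] by (simp add: D_def)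
  then have "f' = (\<lambda>h. h \<bullet> D)"
    by (rule ext)
  then have D: "GDERIV f x :> D"
    using f' unfolding gderiv_def by simp
  have "D' = D" if "GDERIV f x :> D'" for D'
  proof -
    have "(\<lambda>h. h \<bullet> D') = (\<lambda>h. h \<bullet> D)"
      using that D unfolding gderiv_def by (rule has_derivative_unique)
    then show ?thesis
      by (metis vector_eq_ldot)
  qed
  with D show ?thesis
    unfolding gradient_def by (rule theI)
qed

text \<open>Restricting \<open>f\<close> to the line through \<open>x\<close> and \<open>z\<close> reduces this to the tangent inequality for
  convex functions of one real variable.\<close>

lemma convex_on_above_tangent_plane:
  fixes f :: "'a::real_inner \<Rightarrow> real"
  assumes conv: "convex_on UNIV f" and D: "GDERIV f x :> D"
  shows "(z - x) \<bullet> D \<le> f z - f x"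
proof -
  define \<phi> where "\<phi> t = f (x + t *\<^sub>R (z - x))" for t
  have "convex_on UNIV \<phi>"
  proof (rule convex_onI)
    fix t s r :: real
    assume "0 < t" "t < 1"
    moreover have "x + ((1 - t) * s + t * r) *\<^sub>R (z - x)
        = (1 - t) *\<^sub>R (x + s *\<^sub>R (z - x)) + t *\<^sub>R (x + r *\<^sub>R (z - x))"
      by (simp add: algebra_simps)
    ultimately show "\<phi> ((1 - t) *\<^sub>R s + t *\<^sub>R r) \<le> (1 - t) * \<phi> s + t * \<phi> r"
      using convex_onD[OF conv, of t] by (simp add: \<phi>_def)
  qed simp
  moreover have "(\<phi> has_field_derivative (z - x) \<bullet> D) (at 0)"
  proof -
    have "((\<lambda>t. x + t *\<^sub>R (z - x)) has_derivative (\<lambda>t. t *\<^sub>R (z - x))) (at 0)"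
      by (auto intro!: derivative_eq_intros)
    moreover have "(f has_derivative (\<lambda>h. h \<bullet> D)) (at (x + 0 *\<^sub>R (z - x)))"
      using D by (simp add: gderiv_def)
    ultimately have "(\<phi> has_derivative (\<lambda>t. (t *\<^sub>R (z - x)) \<bullet> D)) (at 0)"
      unfolding \<phi>_def by (rule has_derivative_compose)
    then show ?thesis
      by (simp add: has_field_derivative_def mult.commute[of _ "(z - x) \<bullet> D"])
  qed
  ultimately have "((z - x) \<bullet> D) * (1 - 0) \<le> \<phi> 1 - \<phi> 0"
    by (intro convex_on_imp_above_tangent[where A = UNIV]) auto
  then show ?thesis
    by (simp add: \<phi>_def)
qed

lemma Slater_imp_MFCQ:
  fixes g :: "'i \<Rightarrow> 'a::euclidean_space \<Rightarrow> real"
  assumes "\<And>i. i \<in> S \<Longrightarrow> convex_on UNIV (g i)"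
    and "\<And>i. i \<in> S \<Longrightarrow> g i differentiable (at x)"
    and "\<And>i. i \<in> S \<Longrightarrow> g i z < \<mu> i"
  shows "MFCQ S g \<mu> x"
  unfolding MFCQ_def
proof (intro exI ballI impI)
  fix i
  assume "i \<in> S" "g i x = \<mu> i"
  then show "(z - x) \<bullet> gradient (g i) x < 0"
    using convex_on_above_tangent_plane[of "g i" x "gradient (g i) x" z]
      GDERIV_gradient[of "g i" x] assms[of i] by fastforce
qed

text \<open>On the segment from \<open>x\<close> to \<open>y\<close> the convex function \<open>g i\<close> lies below the chord, whose value near
  \<open>x\<close> is below \<open>\<mu> i\<close>: by continuity if it is so at \<open>x\<close>, and because the chord descends strictly if
  it starts at \<open>\<mu> i\<close>. Finitely many such neighbourhoods of \<open>x\<close> on the segment have a common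
  point.\<close>

lemma common_strict_point:
  fixes g :: "'i \<Rightarrow> 'a::real_vector \<Rightarrow> real"
  assumes "finite S"
    and conv: "\<And>i. i \<in> S \<Longrightarrow> convex_on UNIV (g i)"
    and le: "\<And>i. i \<in> S \<Longrightarrow> g i x \<le> \<mu> i"
    and less: "\<And>i. i \<in> S \<Longrightarrow> g i x < \<mu> i \<or> g i y < \<mu> i"
  obtains z where "\<And>i. i \<in> S \<Longrightarrow> g i z < \<mu> i"
proof -
  have "\<forall>\<^sub>F t in at_right 0. (1 - t) * g i x + t * g i y < \<mu> i" if "i \<in> S" for i
  proof (cases "g i x < \<mu> i")
    case True
    have "((\<lambda>t. (1 - t) * g i x + t * g i y) \<longlongrightarrow> (1 - 0) * g i x + 0 * g i y) (at_right 0)"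
      by (intro tendsto_intros)
    then show ?thesis
      using True by (intro order_tendstoD) auto
  next
    case False
    then have "g i x = \<mu> i" "g i y < \<mu> i"
      using le less that by force+
    then have "(1 - t) * g i x + t * g i y < \<mu> i" if "t > 0" for t
      using mult_strict_left_mono[of "g i y" "\<mu> i" t] that by (simp add: algebra_simps)
    with eventually_at_right_less[of "0::real"] show ?thesis
      by (rule eventually_mono)
  qed
  then have "\<forall>\<^sub>F t in at_right 0. \<forall>i\<in>S. (1 - t) * g i x + t * g i y < \<mu> i"
    using \<open>finite S\<close> by (simp add: eventually_ball_finite)
  moreover have "\<forall>\<^sub>F t in at_right (0::real). t \<in> {0<..<1}"
    by (rule eventually_at_right_real) simp
  ultimately have "\<forall>\<^sub>F t in at_right 0.
      t \<in> {0<..<1} \<and> (\<forall>i\<in>S. (1 - t) * g i x + t * g i y < \<mu> i)"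
    by eventually_elim simp
  then have "\<exists>t. t \<in> {0<..<1} \<and> (\<forall>i\<in>S. (1 - t) * g i x + t * g i y < \<mu> i)"
    by (rule eventually_happens'[rotated]) simp
  then obtain t where t: "0 < t" "t < 1"
    and chord: "\<And>i. i \<in> S \<Longrightarrow> (1 - t) * g i x + t * g i y < \<mu> i"
    by auto
  have "g i ((1 - t) *\<^sub>R x + t *\<^sub>R y) < \<mu> i" if "i \<in> S" for i
    using convex_onD[OF conv[OF that], of t x y] chord[OF that] t by simp
  then show thesis
    by (rule that)
qed

theorem corollary3p5:
  fixes g :: "nat \<Rightarrow> real ^ 'n \<Rightarrow> real"
    and \<O> :: "nat \<Rightarrow> real list set set"
    and js :: "'n list"
    and m p :: nat
    and x0 :: "real ^ 'n"
  assumes "o_minimal_structure \<O>"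
    and "distinct js" and "set js = UNIV"
    and "\<And>i. i \<in> {1..m} \<Longrightarrow> g i differentiable_on UNIV"
    and "\<And>i. i \<in> {1..m} \<Longrightarrow> convex_on UNIV (g i)"
    and "\<And>i. i \<in> {1..m} \<Longrightarrow> definable_fun \<O> js (g i)"
    and "{x. \<forall>i\<in>{1..m}. g i x \<le> 0} \<noteq> {}"
    and "p < m"
    and "\<And>i. i \<in> {1..p} \<Longrightarrow> g i x0 < 0"
  shows "\<exists>\<epsilon>>0. \<forall>\<mu>. (\<forall>i\<in>{p+1..m}. \<mu> i \<in> {0<..<\<epsilon>}) \<longrightarrow>
           (let \<nu> = (\<lambda>i. if i \<le> p then 0 else \<mu> i)
            in \<forall>x\<in>constraint_set {1..m} g \<nu>. MFCQ {1..m} g \<nu> x)"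
proof -
  obtain xs where xs: "\<And>i. i \<in> {1..m} \<Longrightarrow> g i xs \<le> 0"
    using assms(7) by blast
  have "MFCQ {1..m} g (\<lambda>i. if i \<le> p then 0 else \<mu> i) x"
    if \<mu>: "\<forall>i\<in>{p+1..m}. \<mu> i \<in> {0<..<1}" for \<mu> x
  proof -
    define \<nu> where "\<nu> i = (if i \<le> p then 0 else \<mu> i)" for i
    have pos: "0 < \<nu> i" if "i \<in> {1..m}" "\<not> i \<le> p" for i
      using \<mu> that by (simp add: \<nu>_def)
    have le: "g i xs \<le> \<nu> i" if "i \<in> {1..m}" for i
      using xs[OF that] pos[OF that] by (cases "i \<le> p") (auto simp: \<nu>_def)
    have less: "g i xs < \<nu> i \<or> g i x0 < \<nu> i" if "i \<in> {1..m}" for i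
    proof (cases "i \<le> p")
      case True
      then show ?thesis
        using assms(9)[of i] that by (simp add: \<nu>_def)
    next
      case False
      then show ?thesis
        using xs[OF that] pos[OF that] by simp
    qed
    obtain z where "\<And>i. i \<in> {1..m} \<Longrightarrow> g i z < \<nu> i"
      using common_strict_point[of "{1..m}" g xs \<nu> x0] assms(5) le less by auto
    moreover have "g i differentiable (at x)" if "i \<in> {1..m}" for i
      using assms(4)[OF that] by (simp add: differentiable_on_def)
    ultimately have "MFCQ {1..m} g \<nu> x"
      using assms(5) by (intro Slater_imp_MFCQ)
    then show ?thesis
      by (simp add: \<nu>_def[abs_def])
  qed
  then show ?thesis
    by (intro exI[of _ 1]) (simp add: Let_def)
qed

end
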